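(* Let $p$ be an odd prime. Then the spectral radius of the adjacency matrix $A_p=A(G_p)$ is $$\rho(A_p)=p^2-p-\frac12+\frac12\sqrt{4p^4-4p^2-8p+9}.$$
   Context: For $n\ge2$, $\mathbb{L}_n=\{a+bi+cj+dk: a,b,c,d\in\mathbb{Z}/n\mathbb{Z}\}$ is the ring of Lipschitz quaternions modulo $n$, with the usual relations $i^2=j^2=k^2=-1$, $ij=k=-ji$, $jk=i=-kj$, $ki=j=-ik$ taken modulo $n$. A nonzero element $x$ of a ring is a zero divisor if $xy=0$ or $yx=0$ for some nonzero $y$. $G_n=\Gamma(\mathbb{L}_n)$ is the simple undirected graph whose vertices are the nonzero zero divisors of $\mathbb{L}_n$, distinct $x,y$ being adjacent iff $xy=0$ or $yx=0$; $A(G_n)$ is its adjacency matrix. (For odd primes $p$, $\mathbb{L}_p\cong M_2(\mathbb{F}_p)$.) *)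

theory Defs
  imports
    Complex_Main
    "HOL-Number_Theory.Residues"
    "Graph_Theory.Pair_Digraph"
    "Jordan_Normal_Form.Spectral_Radius"
begin

text \<open>Hamilton quaternions over a commutative ring; \<open>Quat a b c d\<close> stands for
  \<open>a + b i + c j + d k\<close>.\<close>

datatype 'a quat = Quat 'a 'a 'a 'a

fun quat_mult :: "('a, 'm) ring_scheme \<Rightarrow> 'a quat \<Rightarrow> 'a quat \<Rightarrow> 'a quat" where
  "quat_mult R (Quat a b c d) (Quat a' b' c' d') =
     Quat (a \<otimes>\<^bsub>R\<^esub> a' \<ominus>\<^bsub>R\<^esub> b \<otimes>\<^bsub>R\<^esub> b' \<ominus>\<^bsub>R\<^esub> c \<otimes>\<^bsub>R\<^esub> c' \<ominus>\<^bsub>R\<^esub> d \<otimes>\<^bsub>R\<^esub> d')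
          (a \<otimes>\<^bsub>R\<^esub> b' \<oplus>\<^bsub>R\<^esub> b \<otimes>\<^bsub>R\<^esub> a' \<oplus>\<^bsub>R\<^esub> c \<otimes>\<^bsub>R\<^esub> d' \<ominus>\<^bsub>R\<^esub> d \<otimes>\<^bsub>R\<^esub> c')
          (a \<otimes>\<^bsub>R\<^esub> c' \<ominus>\<^bsub>R\<^esub> b \<otimes>\<^bsub>R\<^esub> d' \<oplus>\<^bsub>R\<^esub> c \<otimes>\<^bsub>R\<^esub> a' \<oplus>\<^bsub>R\<^esub> d \<otimes>\<^bsub>R\<^esub> b')
          (a \<otimes>\<^bsub>R\<^esub> d' \<oplus>\<^bsub>R\<^esub> b \<otimes>\<^bsub>R\<^esub> c' \<ominus>\<^bsub>R\<^esub> c \<otimes>\<^bsub>R\<^esub> b' \<oplus>\<^bsub>R\<^esub> d \<otimes>\<^bsub>R\<^esub> a')"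

fun quat_add :: "('a, 'm) ring_scheme \<Rightarrow> 'a quat \<Rightarrow> 'a quat \<Rightarrow> 'a quat" where
  "quat_add R (Quat a b c d) (Quat a' b' c' d') =
     Quat (a \<oplus>\<^bsub>R\<^esub> a') (b \<oplus>\<^bsub>R\<^esub> b') (c \<oplus>\<^bsub>R\<^esub> c') (d \<oplus>\<^bsub>R\<^esub> d')"

definition quaternion_ring :: "('a, 'm) ring_scheme \<Rightarrow> 'a quat ring" where
  "quaternion_ring R =
     \<lparr>carrier = {Quat a b c d | a b c d.
        a \<in> carrier R \<and> b \<in> carrier R \<and> c \<in> carrier R \<and> d \<in> carrier R},
      monoid.mult = quat_mult R,
      monoid.one = Quat \<one>\<^bsub>R\<^esub> \<zero>\<^bsub>R\<^esub> \<zero>\<^bsub>R\<^esub> \<zero>\<^bsub>R\<^esub>,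
      ring.zero = Quat \<zero>\<^bsub>R\<^esub> \<zero>\<^bsub>R\<^esub> \<zero>\<^bsub>R\<^esub> \<zero>\<^bsub>R\<^esub>,
      ring.add = quat_add R\<rparr>"

definition lipschitz_ring :: "nat \<Rightarrow> int quat ring" where
  "lipschitz_ring n = quaternion_ring (residue_ring (int n))"

definition zero_divisors :: "('a, 'm) ring_scheme \<Rightarrow> 'a set" where
  "zero_divisors R = {x \<in> carrier R. x \<noteq> \<zero>\<^bsub>R\<^esub> \<and>
     (\<exists>y \<in> carrier R. y \<noteq> \<zero>\<^bsub>R\<^esub> \<and> (x \<otimes>\<^bsub>R\<^esub> y = \<zero>\<^bsub>R\<^esub> \<or> y \<otimes>\<^bsub>R\<^esub> x = \<zero>\<^bsub>R\<^esub>))}"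

text \<open>An undirected edge is represented by its two opposite arcs.\<close>

definition zero_divisor_graph :: "('a, 'm) ring_scheme \<Rightarrow> 'a pair_pre_digraph" where
  "zero_divisor_graph R =
     \<lparr>pverts = zero_divisors R,
      parcs = {(x, y). x \<in> zero_divisors R \<and> y \<in> zero_divisors R \<and> x \<noteq> y \<and>
        (x \<otimes>\<^bsub>R\<^esub> y = \<zero>\<^bsub>R\<^esub> \<or> y \<otimes>\<^bsub>R\<^esub> x = \<zero>\<^bsub>R\<^esub>)}\<rparr>"

text \<open>The list \<open>vs\<close> fixes the order in which rows and columns are indexed by vertices;
  it should enumerate \<open>pverts G\<close> without repetition. The entries are complex because
  \<^const>\<open>spectral_radius\<close> is defined for complex matrices.\<close>

definition adjacency_matrix :: "'a pair_pre_digraph \<Rightarrow> 'a list \<Rightarrow> complex mat" where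
  "adjacency_matrix G vs = mat (length vs) (length vs)
     (\<lambda>(i, j). if (vs ! i, vs ! j) \<in> parcs G then 1 else 0)"


lemma quaternion_ring_simps:
  "carrier (quaternion_ring R) = {Quat a b c d | a b c d.
     a \<in> carrier R \<and> b \<in> carrier R \<and> c \<in> carrier R \<and> d \<in> carrier R}"
  "x \<otimes>\<^bsub>quaternion_ring R\<^esub> y = quat_mult R x y"
  "\<one>\<^bsub>quaternion_ring R\<^esub> = Quat \<one>\<^bsub>R\<^esub> \<zero>\<^bsub>R\<^esub> \<zero>\<^bsub>R\<^esub> \<zero>\<^bsub>R\<^esub>"
  "\<zero>\<^bsub>quaternion_ring R\<^esub> = Quat \<zero>\<^bsub>R\<^esub> \<zero>\<^bsub>R\<^esub> \<zero>\<^bsub>R\<^esub> \<zero>\<^bsub>R\<^esub>"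
  "x \<oplus>\<^bsub>quaternion_ring R\<^esub> y = quat_add R x y"
  by (simp_all add: quaternion_ring_def)

lemma (in cring) ring_quaternion_ring: "ring (quaternion_ring R)"
proof (rule ringI)
  show "abelian_group (quaternion_ring R)"
  proof (rule abelian_groupI)
    fix x assume "x \<in> carrier (quaternion_ring R)"
    then obtain a b c d where "x = Quat a b c d"
      and "a \<in> carrier R" "b \<in> carrier R" "c \<in> carrier R" "d \<in> carrier R"
      by (auto simp: quaternion_ring_simps)
    then show "\<exists>y\<in>carrier (quaternion_ring R).
        y \<oplus>\<^bsub>quaternion_ring R\<^esub> x = \<zero>\<^bsub>quaternion_ring R\<^esub>"
      by (intro bexI[of _ "Quat (\<ominus> a) (\<ominus> b) (\<ominus> c) (\<ominus> d)"])
        (auto simp: quaternion_ring_simps l_neg)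
  qed (auto simp: quaternion_ring_simps a_ac)
  show "Group.monoid (quaternion_ring R)"
    by (rule monoidI) (auto simp: quaternion_ring_simps ring_simprules)
qed (auto simp: quaternion_ring_simps ring_simprules)

lemma ring_lipschitz_ring: "n \<ge> 2 \<Longrightarrow> ring (lipschitz_ring n)"
  unfolding lipschitz_ring_def
  by (intro cring.ring_quaternion_ring residues.cring) (simp add: residues_def)

lemma (in cring) quaternion_relations:
  fixes i j k m
  defines "i \<equiv> Quat \<zero> \<one> \<zero> \<zero>" and "j \<equiv> Quat \<zero> \<zero> \<one> \<zero>" and "k \<equiv> Quat \<zero> \<zero> \<zero> \<one>"
    and "m \<equiv> \<lambda>x. \<ominus>\<^bsub>quaternion_ring R\<^esub> x"
  shows "quat_mult R i i = m (\<one>\<^bsub>quaternion_ring R\<^esub>)"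
    "quat_mult R j j = m (\<one>\<^bsub>quaternion_ring R\<^esub>)"
    "quat_mult R k k = m (\<one>\<^bsub>quaternion_ring R\<^esub>)"
    "quat_mult R i j = k" "quat_mult R j i = m k"
    "quat_mult R j k = i" "quat_mult R k j = m i"
    "quat_mult R k i = j" "quat_mult R i k = m j"
proof -
  interpret Q: ring "quaternion_ring R" by (rule ring_quaternion_ring)
  have m: "m (Quat a b c d) = Quat (\<ominus> a) (\<ominus> b) (\<ominus> c) (\<ominus> d)"
    if "a \<in> carrier R" "b \<in> carrier R" "c \<in> carrier R" "d \<in> carrier R" for a b c d
    unfolding m_def
    by (rule Q.minus_equality) (use that in \<open>auto simp: quaternion_ring_simps l_neg\<close>)
  show "quat_mult R i i = m (\<one>\<^bsub>quaternion_ring R\<^esub>)"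
    "quat_mult R j j = m (\<one>\<^bsub>quaternion_ring R\<^esub>)"
    "quat_mult R k k = m (\<one>\<^bsub>quaternion_ring R\<^esub>)"
    "quat_mult R i j = k" "quat_mult R j i = m k"
    "quat_mult R j k = i" "quat_mult R k j = m i"
    "quat_mult R k i = j" "quat_mult R i k = m j"
    by (simp_all add: i_def j_def k_def m quaternion_ring_simps minus_eq)
qed

lemma finite_zero_divisors_lipschitz_ring: "finite (zero_divisors (lipschitz_ring n))"
proof -
  let ?Z = "{0..int n - 1}"
  have "carrier (lipschitz_ring n) \<subseteq>
      (\<lambda>(a, b, c, d). Quat a b c d) ` (?Z \<times> ?Z \<times> ?Z \<times> ?Z)"
    by (auto simp: lipschitz_ring_def quaternion_ring_simps residue_ring_def image_iff)
  then have "finite (carrier (lipschitz_ring n))"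
    by (rule finite_subset) simp
  then show ?thesis by (simp add: zero_divisors_def)
qed

lemma pair_graph_zero_divisor_graph:
  assumes "finite (zero_divisors R)"
  shows "pair_graph (zero_divisor_graph R)"
proof -
  have "finite (parcs (zero_divisor_graph R))"
    by (rule finite_subset[of _ "zero_divisors R \<times> zero_divisors R"])
      (use assms in \<open>auto simp: zero_divisor_graph_def\<close>)
  then show ?thesis
    using assms
    by unfold_locales (auto simp: zero_divisor_graph_def symmetric_def intro!: symI)
qed

end

theory Submission
  imports Defs
begin

text \<open>
  Let \<open>F\<close> be a finite field with \<open>q\<close> elements and odd characteristic, \<open>Q\<close> the quaternions over \<open>F\<close>,
  \<open>x \<mapsto> conj x\<close> quaternion conjugation, \<open>tr x = x + conj x\<close> and \<open>nrm x = x conj x\<close>. The zero divisors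
  are the nonzero isotropic quaternions, those with \<open>nrm x = 0\<close>; by the Cayley-Hamilton identity
  \<open>x\<^sup>2 = tr x \<cdot> x - nrm x\<close> such an \<open>x\<close> is nilpotent exactly if \<open>tr x = 0\<close>. How many nilpotent and how
  many non-nilpotent neighbours a vertex has depends only on whether it is nilpotent itself.
  Hence a vector that takes one value on the nilpotent vertices and another one on the remaining
  vertices is mapped by the adjacency matrix to a vector of the same kind, and the action on the two
  values is given by
  \<open>(q - 2, 2q(q - 1); 2(q - 1), (2q - 1)(q - 1))\<close>. The larger eigenvalue of this matrix is the
  claimed number, and it belongs to a vector with two positive values. A positive eigenvector
  of a nonnegative matrix belongs to the spectral radius
  (\<open>spectral_radius_eq_of_positive_eigenvector\<close>).

  The neighbours of \<open>x\<close> are the elements of the right annihilator \<open>R(x) = {y. x y = 0}\<close> and of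
  the left annihilator \<open>L(x)\<close>, apart from \<open>0\<close> and \<open>x\<close>. They are counted without identifying \<open>Q\<close>
  with a matrix ring. Since the form \<open>tr (z x)\<close> is nondegenerate, every isotropic \<open>x \<noteq> 0\<close> has a
  \<open>z\<close> with \<open>z x + conj x conj z = 1\<close>. Multiplying by \<open>y \<in> R(x)\<close> yields \<open>R(x) = conj x \<cdot> Q\<close>, and
  the same trick on both sides yields \<open>R(x) \<inter> L(x) = F \<cdot> conj x\<close>. Left multiplication by \<open>x\<close> has
  kernel \<open>R(x)\<close> and image \<open>R(conj x)\<close>, so \<open>|R(x)| |R(conj x)| = q\<^sup>4\<close>. For nilpotent \<open>x\<close>, where
  \<open>conj x = - x\<close>, this means \<open>|R(x)| = q\<^sup>2\<close>. For arbitrary isotropic \<open>x\<close>, the set \<open>R(x)\<close> contains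
  a nilpotent \<open>y \<noteq> 0\<close> and thus the \<open>q\<^sup>2\<close> elements of \<open>y Q\<close>; with the product formula,
  \<open>|R(x)| = q\<^sup>2\<close> again (\<open>card_rann\<close>). The trace maps \<open>R(x)\<close> onto \<open>F\<close>, which leaves \<open>q\<close> elements of
  trace zero, and inclusion-exclusion for \<open>R(x) \<union> L(x)\<close> gives the four entries above.

  That the graph has a vertex at all rests on the solvability of \<open>1 + a\<^sup>2 + b\<^sup>2 = 0\<close> in \<open>F\<close>.
\<close>

section \<open>The spectral radius of a nonnegative matrix with a positive eigenvector\<close>

text \<open>If \<open>A w = k w\<close>, compare \<open>|w|\<close> with the positive eigenvector: let \<open>m\<close> be the largest of the ratios
  \<open>|w\<^sub>i| / v\<^sub>i\<close>. At an index \<open>i\<close> where it is attained, the triangle inequality gives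
  \<open>|k| m v\<^sub>i \<le> (\<Sum>j. a\<^sub>i\<^sub>j m v\<^sub>j) = r m v\<^sub>i\<close>.\<close>

lemma spectral_radius_eq_of_positive_eigenvector:
  fixes A :: "complex mat" and a :: "nat \<Rightarrow> nat \<Rightarrow> real" and v :: "nat \<Rightarrow> real"
  assumes A: "A \<in> carrier_mat n n" and n: "n > 0"
    and entry: "\<And>i j. i < n \<Longrightarrow> j < n \<Longrightarrow> A $$ (i, j) = of_real (a i j)"
    and nonneg: "\<And>i j. i < n \<Longrightarrow> j < n \<Longrightarrow> a i j \<ge> 0"
    and pos: "\<And>i. i < n \<Longrightarrow> v i > 0"
    and eigen: "\<And>i. i < n \<Longrightarrow> (\<Sum>j<n. a i j * v j) = r * v i"
  shows "spectral_radius A = r"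
proof -
  have mult: "(A *\<^sub>v w) $ i = (\<Sum>j<n. of_real (a i j) * w $ j)"
    if "w \<in> carrier_vec n" "i < n" for w i
    using that A entry by (simp add: scalar_prod_def atLeast0LessThan)
  have "0 \<le> (\<Sum>j<n. a 0 j * v j)"
    using nonneg[of 0] pos n by (intro sum_nonneg mult_nonneg_nonneg) (auto simp: less_imp_le)
  then have "r \<ge> 0" using eigen[of 0] pos[of 0] n by (simp add: zero_le_mult_iff)
  have "eigenvector A (vec n (\<lambda>i. of_real (v i))) (of_real r)"
    unfolding eigenvector_def
  proof (intro conjI)
    show "vec n (\<lambda>i. complex_of_real (v i)) \<in> carrier_vec (dim_row A)" using A by simp
    show "vec n (\<lambda>i. complex_of_real (v i)) \<noteq> 0\<^sub>v (dim_row A)"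
    proof
      assume "vec n (\<lambda>i. complex_of_real (v i)) = 0\<^sub>v (dim_row A)"
      then have "vec n (\<lambda>i. complex_of_real (v i)) $ 0 = 0" using n A by simp
      then show False using n pos[of 0] by simp
    qed
    show "A *\<^sub>v vec n (\<lambda>i. complex_of_real (v i)) = of_real r \<cdot>\<^sub>v vec n (\<lambda>i. complex_of_real (v i))"
    proof (rule eq_vecI)
      fix i assume "i < dim_vec (of_real r \<cdot>\<^sub>v vec n (\<lambda>i. complex_of_real (v i)))"
      then have i: "i < n" by simp
      have "(A *\<^sub>v vec n (\<lambda>i. complex_of_real (v i))) $ i = of_real (\<Sum>j<n. a i j * v j)"
        using i by (subst mult) auto
      then show "(A *\<^sub>v vec n (\<lambda>i. complex_of_real (v i))) $ i
          = (of_real r \<cdot>\<^sub>v vec n (\<lambda>i. complex_of_real (v i))) $ i"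
        using i eigen[OF i] by simp
    qed (use A in simp)
  qed
  then have mem: "complex_of_real r \<in> spectrum A"
    by (auto simp: spectrum_def eigenvalue_def)
  have bound: "norm k \<le> r" if k: "k \<in> spectrum A" for k
  proof -
    obtain w where "eigenvector A w k"
      using k by (auto simp: spectrum_def eigenvalue_def)
    then have w: "w \<in> carrier_vec n" "w \<noteq> 0\<^sub>v n" "A *\<^sub>v w = k \<cdot>\<^sub>v w"
      using A by (auto simp: eigenvector_def)
    define m where "m = Max ((\<lambda>i. norm (w $ i) / v i) ` {..<n})"
    have le: "norm (w $ j) \<le> m * v j" if "j < n" for j
    proof -
      have "norm (w $ j) / v j \<le> m" unfolding m_def using that by (intro Max_ge) auto
      then show ?thesis using pos[OF that] by (simp add: pos_divide_le_eq)
    qed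
    have "m \<in> (\<lambda>i. norm (w $ i) / v i) ` {..<n}"
      unfolding m_def using n by (intro Max_in) auto
    then obtain i where i: "i < n" "m = norm (w $ i) / v i" by auto
    have m_pos: "m > 0"
    proof (rule ccontr)
      assume "\<not> m > 0"
      have "w $ j = 0" if "j < n" for j
      proof -
        have "m * v j \<le> 0" using \<open>\<not> m > 0\<close> pos[OF that] by (simp add: mult_nonpos_nonneg)
        then have "norm (w $ j) \<le> 0" using le[OF that] by linarith
        then show ?thesis by simp
      qed
      then have "w = 0\<^sub>v n" using w(1) by (intro eq_vecI) auto
      then show False using w(2) by simp
    qed
    have wi: "norm (w $ i) = m * v i" using i pos[OF i(1)] by simp
    have "k * w $ i = (\<Sum>j<n. of_real (a i j) * w $ j)"
      using mult[OF w(1) i(1)] w i(1) by simp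
    then have "norm k * (m * v i) = norm (\<Sum>j<n. of_real (a i j) * w $ j)"
      by (metis norm_mult wi)
    also have "\<dots> \<le> (\<Sum>j<n. a i j * (m * v j))"
      using i(1) nonneg le by (intro sum_norm_le) (auto simp: norm_mult intro!: mult_left_mono)
    also have "\<dots> = r * (m * v i)"
      using eigen[OF i(1)] by (simp add: mult.left_commute sum_distrib_left[symmetric])
    finally show ?thesis using m_pos pos[OF i(1)] by simp
  qed
  show ?thesis
    unfolding spectral_radius_def
  proof (rule Max_eqI)
    show "finite (norm ` spectrum A)" using card_finite_spectrum(1)[OF A] by simp
    show "r \<in> norm ` spectrum A" using mem \<open>r \<ge> 0\<close> by (intro image_eqI[OF _ mem]) simp
  qed (use bound in auto)
qed


section \<open>Counting the fibres of an additive map\<close>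

lemma card_eq_card_image_mult_card_kernel:
  fixes G (structure)
  assumes "abelian_group G" "abelian_group H" "finite A"
    and A: "A \<subseteq> carrier G"
    and closed: "\<And>x y. x \<in> A \<Longrightarrow> y \<in> A \<Longrightarrow> x \<oplus> y \<in> A"
      "\<And>x. x \<in> A \<Longrightarrow> \<ominus> x \<in> A"
    and f: "\<And>x. x \<in> A \<Longrightarrow> f x \<in> carrier H"
      "\<And>x y. x \<in> A \<Longrightarrow> y \<in> A \<Longrightarrow> f (x \<oplus> y) = f x \<oplus>\<^bsub>H\<^esub> f y"
  shows "card A = card (f ` A) * card {x \<in> A. f x = \<zero>\<^bsub>H\<^esub>}"
proof -
  interpret G: abelian_group G by fact
  interpret H: abelian_group H by fact
  have fibre: "card {x \<in> A. f x = b} = card {x \<in> A. f x = \<zero>\<^bsub>H\<^esub>}" if "b \<in> f ` A" for b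
  proof -
    from that obtain a where a: "a \<in> A" "f a = b" by auto
    have cancel: "f x = \<zero>\<^bsub>H\<^esub>" if "x \<in> A" "f (x \<oplus> a) = b" for x
      using f(2)[of x a] f(1)[of x] f(1)[of a] a that
      by (metis H.add.l_cancel_one' H.add.m_comm H.r_zero)
    have "bij_betw (\<lambda>x. x \<oplus> a) {x \<in> A. f x = \<zero>\<^bsub>H\<^esub>} {x \<in> A. f x = b}"
    proof (intro bij_betwI[where g = "\<lambda>y. y \<oplus> \<ominus> a"])
      show "(\<lambda>x. x \<oplus> a) \<in> {x \<in> A. f x = \<zero>\<^bsub>H\<^esub>} \<rightarrow> {x \<in> A. f x = b}"
        using a closed f by auto
      show "(\<lambda>y. y \<oplus> \<ominus> a) \<in> {x \<in> A. f x = b} \<rightarrow> {x \<in> A. f x = \<zero>\<^bsub>H\<^esub>}"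
      proof
        fix y assume y: "y \<in> {x \<in> A. f x = b}"
        have "(y \<oplus> \<ominus> a) \<oplus> a = y"
          using y a A by (simp add: subset_iff G.a_assoc G.l_neg)
        then show "y \<oplus> \<ominus> a \<in> {x \<in> A. f x = \<zero>\<^bsub>H\<^esub>}"
          using cancel[of "y \<oplus> \<ominus> a"] y a closed by auto
      qed
    qed (use a A in \<open>simp_all add: subset_iff G.a_assoc G.l_neg G.r_neg\<close>)
    then show ?thesis by (simp add: bij_betw_same_card)
  qed
  have "card A = (\<Sum>b\<in>f ` A. card {x \<in> A. f x = b})"
    using sum.image_gen[OF \<open>finite A\<close>, of "\<lambda>_. 1::nat" f] by simp
  also have "\<dots> = card (f ` A) * card {x \<in> A. f x = \<zero>\<^bsub>H\<^esub>}"
    using fibre by simp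
  finally show ?thesis .
qed


section \<open>Quaternions over a finite field of odd characteristic\<close>

fun qconj :: "('a, 'm) ring_scheme \<Rightarrow> 'a quat \<Rightarrow> 'a quat" where
  "qconj R (Quat a b c d) = Quat a (\<ominus>\<^bsub>R\<^esub> b) (\<ominus>\<^bsub>R\<^esub> c) (\<ominus>\<^bsub>R\<^esub> d)"

fun qtrace :: "('a, 'm) ring_scheme \<Rightarrow> 'a quat \<Rightarrow> 'a" where
  "qtrace R (Quat a b c d) = a \<oplus>\<^bsub>R\<^esub> a"

fun qnorm :: "('a, 'm) ring_scheme \<Rightarrow> 'a quat \<Rightarrow> 'a" where
  "qnorm R (Quat a b c d) =
     a \<otimes>\<^bsub>R\<^esub> a \<oplus>\<^bsub>R\<^esub> b \<otimes>\<^bsub>R\<^esub> b \<oplus>\<^bsub>R\<^esub> c \<otimes>\<^bsub>R\<^esub> c \<oplus>\<^bsub>R\<^esub> d \<otimes>\<^bsub>R\<^esub> d"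

definition qscalar :: "('a, 'm) ring_scheme \<Rightarrow> 'a \<Rightarrow> 'a quat" where
  "qscalar R a = Quat a \<zero>\<^bsub>R\<^esub> \<zero>\<^bsub>R\<^esub> \<zero>\<^bsub>R\<^esub>"

locale finite_odd_field = field R for R (structure) +
  assumes finite_carrier: "finite (carrier R)"
    and two_nonzero: "\<one> \<oplus> \<one> \<noteq> \<zero>"
begin

abbreviation Q where "Q \<equiv> quaternion_ring R"
abbreviation conj where "conj \<equiv> qconj R"
abbreviation tr where "tr \<equiv> qtrace R"
abbreviation nrm where "nrm \<equiv> qnorm R"
abbreviation sc where "sc \<equiv> qscalar R"
abbreviation qmul (infixl "\<star>" 70) where "x \<star> y \<equiv> x \<otimes>\<^bsub>Q\<^esub> y"
abbreviation qzero ("\<zero>\<^sub>Q") where "\<zero>\<^sub>Q \<equiv> \<zero>\<^bsub>Q\<^esub>"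
abbreviation q where "q \<equiv> card (carrier R)"

sublocale quat: ring "quaternion_ring R"
  by (rule ring_quaternion_ring)

lemma quat_cases:
  assumes "x \<in> carrier Q"
  obtains a b c d where "x = Quat a b c d" "a \<in> carrier R" "b \<in> carrier R" "c \<in> carrier R" "d \<in> carrier R"
  using assms by (auto simp: quaternion_ring_simps)

lemma conj_closed [simp]: "x \<in> carrier Q \<Longrightarrow> conj x \<in> carrier Q"
  by (auto simp: quaternion_ring_simps)

lemma sc_closed [simp]: "a \<in> carrier R \<Longrightarrow> sc a \<in> carrier Q"
  by (auto simp: quaternion_ring_simps qscalar_def)

lemma tr_closed [simp]: "x \<in> carrier Q \<Longrightarrow> tr x \<in> carrier R"
  by (auto simp: quaternion_ring_simps)

lemma nrm_closed [simp]: "x \<in> carrier Q \<Longrightarrow> nrm x \<in> carrier R"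
  by (auto simp: quaternion_ring_simps)

lemma conj_conj [simp]: "x \<in> carrier Q \<Longrightarrow> conj (conj x) = x"
  by (auto simp: quaternion_ring_simps)

lemma conj_zero [simp]: "conj \<zero>\<^sub>Q = \<zero>\<^sub>Q"
  by (auto simp: quaternion_ring_simps)

lemma conj_eq_zero [simp]: "x \<in> carrier Q \<Longrightarrow> conj x = \<zero>\<^sub>Q \<longleftrightarrow> x = \<zero>\<^sub>Q"
  by (metis conj_conj conj_zero)

lemma conj_mult: "x \<in> carrier Q \<Longrightarrow> y \<in> carrier Q \<Longrightarrow> conj (x \<star> y) = conj y \<star> conj x"
  by (auto simp: quaternion_ring_simps cring_simprules)

lemma tr_add: "x \<in> carrier Q \<Longrightarrow> y \<in> carrier Q \<Longrightarrow> tr (x \<oplus>\<^bsub>Q\<^esub> y) = tr x \<oplus> tr y"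
  by (auto simp: quaternion_ring_simps cring_simprules)

lemma tr_conj [simp]: "x \<in> carrier Q \<Longrightarrow> tr (conj x) = tr x"
  by (auto simp: quaternion_ring_simps)

lemma tr_zero [simp]: "tr \<zero>\<^sub>Q = \<zero>"
  by (auto simp: quaternion_ring_simps)

lemma tr_mult_comm: "x \<in> carrier Q \<Longrightarrow> y \<in> carrier Q \<Longrightarrow> tr (x \<star> y) = tr (y \<star> x)"
  by (auto simp: quaternion_ring_simps cring_simprules)

lemma tr_sc_mult: "a \<in> carrier R \<Longrightarrow> x \<in> carrier Q \<Longrightarrow> tr (sc a \<star> x) = a \<otimes> tr x"
  by (auto simp: quaternion_ring_simps cring_simprules qscalar_def)

lemma sc_central: "a \<in> carrier R \<Longrightarrow> x \<in> carrier Q \<Longrightarrow> x \<star> sc a = sc a \<star> x"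
  by (auto simp: quaternion_ring_simps cring_simprules qscalar_def)

lemma sc_mult: "a \<in> carrier R \<Longrightarrow> b \<in> carrier R \<Longrightarrow> sc (a \<otimes> b) = sc a \<star> sc b"
  by (auto simp: quaternion_ring_simps cring_simprules qscalar_def)

lemma sc_one: "sc \<one> = \<one>\<^bsub>Q\<^esub>" and sc_zero [simp]: "sc \<zero> = \<zero>\<^sub>Q"
  by (auto simp: quaternion_ring_simps qscalar_def)

lemma add_conj: "x \<in> carrier Q \<Longrightarrow> x \<oplus>\<^bsub>Q\<^esub> conj x = sc (tr x)"
  by (auto simp: quaternion_ring_simps cring_simprules qscalar_def)

lemma mult_conj: "x \<in> carrier Q \<Longrightarrow> x \<star> conj x = sc (nrm x)"
proof -
  have cancel: "u \<oplus> (v \<oplus> (\<ominus> u \<oplus> \<ominus> v)) = \<zero>" if "u \<in> carrier R" "v \<in> carrier R" for u v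
    using that by (metis a_assoc a_closed a_inv_closed minus_add r_neg)
  assume "x \<in> carrier Q"
  then show ?thesis
    by (auto simp: quaternion_ring_simps cring_simprules qscalar_def cancel)
qed

lemma nrm_conj [simp]: "x \<in> carrier Q \<Longrightarrow> nrm (conj x) = nrm x"
  by (auto simp: quaternion_ring_simps cring_simprules)

lemma conj_mult_self: "x \<in> carrier Q \<Longrightarrow> conj x \<star> x = sc (nrm x)"
  using mult_conj[of "conj x"] by simp

lemma sc_mult_eq_zero:
  assumes "a \<in> carrier R" "x \<in> carrier Q" "sc a \<star> x = \<zero>\<^sub>Q" "a \<noteq> \<zero>"
  shows "x = \<zero>\<^sub>Q"
proof -
  have inv_a: "inv a \<in> carrier R" "inv a \<otimes> a = \<one>"
    using assms by (auto simp: field_Units Units_l_inv)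
  have "x = sc (inv a \<otimes> a) \<star> x"
    using assms inv_a by (simp add: sc_one)
  also have "\<dots> = sc (inv a) \<star> sc a \<star> x"
    using assms inv_a(1) by (subst sc_mult) auto
  also have "\<dots> = sc (inv a) \<star> (sc a \<star> x)"
    using assms inv_a(1) by (intro quat.m_assoc) auto
  finally show ?thesis using assms by (simp add: inv_a)
qed

lemma double_eq_zero:
  assumes "a \<in> carrier R"
  shows "a \<oplus> a = \<zero> \<longleftrightarrow> a = \<zero>"
proof -
  have "a \<oplus> a = (\<one> \<oplus> \<one>) \<otimes> a" using assms by (simp add: l_distr)
  then show ?thesis using assms two_nonzero integral_iff[of "\<one> \<oplus> \<one>" a] by auto
qed

lemma quat_double_eq_zero: "x \<in> carrier Q \<Longrightarrow> x \<oplus>\<^bsub>Q\<^esub> x = \<zero>\<^sub>Q \<Longrightarrow> x = \<zero>\<^sub>Q"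
  by (auto simp: quaternion_ring_simps double_eq_zero)

text \<open>The traces of \<open>x\<close>, \<open>- i x\<close>, \<open>- j x\<close> and \<open>- k x\<close> are twice the four coordinates of \<open>x\<close>,
  so in odd characteristic one of them is nonzero and can be scaled to \<open>1\<close>.\<close>

lemma trace_form_nondegenerate:
  assumes x: "x \<in> carrier Q" "x \<noteq> \<zero>\<^sub>Q"
  obtains z where "z \<in> carrier Q" "tr (z \<star> x) = \<one>"
proof -
  obtain w where w: "w \<in> carrier Q" "tr (w \<star> x) \<noteq> \<zero>"
  proof (rule ccontr)
    assume "\<not> thesis"
    then have all: "\<And>w. w \<in> carrier Q \<Longrightarrow> tr (w \<star> x) = \<zero>" using that by blast
    obtain a b c d where X: "x = Quat a b c d"
      and m: "a \<in> carrier R" "b \<in> carrier R" "c \<in> carrier R" "d \<in> carrier R"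
      using x quat_cases by metis
    have "a = \<zero>" "b = \<zero>" "c = \<zero>" "d = \<zero>"
      using all[of "Quat \<one> \<zero> \<zero> \<zero>"] all[of "Quat \<zero> (\<ominus> \<one>) \<zero> \<zero>"]
        all[of "Quat \<zero> \<zero> (\<ominus> \<one>) \<zero>"] all[of "Quat \<zero> \<zero> \<zero> (\<ominus> \<one>)"] X m
      by (simp_all add: quaternion_ring_simps cring_simprules double_eq_zero)
    with X x show False by (simp add: quaternion_ring_simps)
  qed
  let ?z = "sc (inv (tr (w \<star> x))) \<star> w"
  have "tr (?z \<star> x) = \<one>"
    using w x by (simp add: quat.m_assoc tr_sc_mult field_Units)
  with w x show thesis by (intro that[of ?z]) (auto simp: field_Units)
qed


section \<open>Annihilators of isotropic quaternions\<close>

definition rann where "rann x = {y \<in> carrier Q. x \<star> y = \<zero>\<^sub>Q}"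
definition lann where "lann x = {y \<in> carrier Q. y \<star> x = \<zero>\<^sub>Q}"

lemma finite_quat: "finite (carrier Q)"
  and card_quat: "card (carrier Q) = q ^ 4"
proof -
  let ?A = "carrier R \<times> carrier R \<times> carrier R \<times> carrier R"
  let ?f = "\<lambda>(a, b, c, d). Quat a b c d"
  have eq: "carrier Q = ?f ` ?A" by (auto simp: quaternion_ring_simps image_iff)
  have inj: "inj_on ?f ?A" by (auto simp: inj_on_def)
  show "finite (carrier Q)" unfolding eq using finite_carrier by simp
  show "card (carrier Q) = q ^ 4"
    unfolding eq card_image[OF inj] by (simp add: card_cartesian_product power4_eq_xxxx)
qed

lemma finite_rann [simp]: "finite (rann x)" and finite_lann [simp]: "finite (lann x)"
  using finite_quat by (simp_all add: rann_def lann_def)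

lemma two_le_q: "2 \<le> q"
proof -
  have "card {\<zero>, \<one>} \<le> q" using finite_carrier by (intro card_mono) auto
  then show ?thesis by simp
qed

lemma nrm_zero_mult_conj:
  assumes "x \<in> carrier Q" "nrm x = \<zero>"
  shows "x \<star> conj x = \<zero>\<^sub>Q" "conj x \<star> x = \<zero>\<^sub>Q"
  using assms by (simp_all add: mult_conj conj_mult_self)

text \<open>Multiplying \<open>x y = 0\<close> by \<open>conj x\<close> on the left turns it into \<open>nrm x \<cdot> y = 0\<close>.\<close>

lemma nrm_zero_of_mult_zero:
  assumes "x \<in> carrier Q" "y \<in> carrier Q" "x \<star> y = \<zero>\<^sub>Q" "y \<noteq> \<zero>\<^sub>Q"
  shows "nrm x = \<zero>"
proof (rule ccontr)
  assume "nrm x \<noteq> \<zero>"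
  moreover have "sc (nrm x) \<star> y = \<zero>\<^sub>Q"
    using assms by (simp add: conj_mult_self [symmetric] quat.m_assoc)
  ultimately show False using assms sc_mult_eq_zero[of "nrm x" y] by simp
qed

lemma nrm_zero_of_mult_zero':
  assumes "x \<in> carrier Q" "y \<in> carrier Q" "x \<star> y = \<zero>\<^sub>Q" "x \<noteq> \<zero>\<^sub>Q"
  shows "nrm y = \<zero>"
  using nrm_zero_of_mult_zero[of "conj y" "conj x"] assms conj_mult[of x y] by simp

lemma zero_divisors_quaternion_ring:
  "zero_divisors Q = {x \<in> carrier Q. x \<noteq> \<zero>\<^sub>Q \<and> nrm x = \<zero>}"
  unfolding zero_divisors_def
  using nrm_zero_of_mult_zero nrm_zero_of_mult_zero' nrm_zero_mult_conj conj_eq_zero conj_closed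
  by (safe; metis)

text \<open>The choice of \<open>z\<close> makes \<open>z x + conj x conj z\<close> equal to \<open>1\<close>, and the first summand kills \<open>y\<close>.
  So \<open>conj x conj z\<close> acts on the right annihilator of \<open>x\<close> as a left identity.\<close>

lemma absorb_rann:
  assumes "x \<in> carrier Q" "z \<in> carrier Q" "tr (z \<star> x) = \<one>" "y \<in> rann x"
  shows "y = conj x \<star> (conj z \<star> y)"
proof -
  have y: "y \<in> carrier Q" "x \<star> y = \<zero>\<^sub>Q" using assms by (auto simp: rann_def)
  have "y = (z \<star> x \<oplus>\<^bsub>Q\<^esub> conj x \<star> conj z) \<star> y"
    using assms y add_conj[of "z \<star> x"] by (simp add: conj_mult sc_one)
  also have "\<dots> = conj x \<star> (conj z \<star> y)"
    using assms y by (simp add: quat.l_distr quat.m_assoc)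
  finally show ?thesis .
qed

lemma absorb_lann:
  assumes "x \<in> carrier Q" "z \<in> carrier Q" "tr (x \<star> z) = \<one>" "y \<in> lann x"
  shows "y = y \<star> conj z \<star> conj x"
proof -
  have y: "y \<in> carrier Q" "y \<star> x = \<zero>\<^sub>Q" using assms by (auto simp: lann_def)
  have "y = y \<star> (x \<star> z \<oplus>\<^bsub>Q\<^esub> conj z \<star> conj x)"
    using assms y add_conj[of "x \<star> z"] by (simp add: conj_mult sc_one)
  also have "\<dots> = y \<star> conj z \<star> conj x"
    using assms y by (simp add: quat.r_distr quat.m_assoc[symmetric])
  finally show ?thesis .
qed

lemma rann_eq_right_ideal:
  assumes x: "x \<in> carrier Q" "x \<noteq> \<zero>\<^sub>Q" "nrm x = \<zero>"
  shows "rann x = (\<lambda>w. conj x \<star> w) ` carrier Q"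
proof
  obtain z where z: "z \<in> carrier Q" "tr (z \<star> x) = \<one>"
    using trace_form_nondegenerate x by blast
  show "rann x \<subseteq> (\<lambda>w. conj x \<star> w) ` carrier Q"
  proof
    fix y assume "y \<in> rann x"
    then show "y \<in> (\<lambda>w. conj x \<star> w) ` carrier Q"
      using absorb_rann[of x z y] x z by (auto simp: rann_def)
  qed
  show "(\<lambda>w. conj x \<star> w) ` carrier Q \<subseteq> rann x"
    using x by (auto simp: rann_def quat.m_assoc[symmetric] nrm_zero_mult_conj)
qed

text \<open>Multiply \<open>x w + conj w conj x = tr (x w)\<close> by \<open>x\<close> on the right; the second summand vanishes since
  \<open>conj x x = nrm x = 0\<close>.\<close>

lemma sandwich:
  assumes "x \<in> carrier Q" "nrm x = \<zero>" "w \<in> carrier Q"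
  shows "x \<star> w \<star> x = sc (tr (x \<star> w)) \<star> x"
proof -
  have "sc (tr (x \<star> w)) \<star> x = (x \<star> w \<oplus>\<^bsub>Q\<^esub> conj w \<star> conj x) \<star> x"
    using assms add_conj[of "x \<star> w"] by (simp add: conj_mult)
  also have "\<dots> = x \<star> w \<star> x \<oplus>\<^bsub>Q\<^esub> conj w \<star> (conj x \<star> x)"
    using assms by (simp add: quat.l_distr quat.m_assoc)
  finally show ?thesis using assms by (simp add: nrm_zero_mult_conj)
qed

definition line where "line x = (\<lambda>a. sc a \<star> x) ` carrier R"

text \<open>The coefficient \<open>a\<close> can be read off from \<open>a x\<close> as \<open>tr (a x z)\<close> when \<open>tr (x z) = 1\<close>.\<close>

lemma card_line:
  assumes "x \<in> carrier Q" "x \<noteq> \<zero>\<^sub>Q"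
  shows "card (line x) = q"
proof -
  obtain z where z: "z \<in> carrier Q" "tr (z \<star> x) = \<one>"
    using trace_form_nondegenerate assms by blast
  have "a = tr (sc a \<star> x \<star> z)" if "a \<in> carrier R" for a
    using that z assms by (simp add: quat.m_assoc tr_sc_mult tr_mult_comm[of x z])
  then have "inj_on (\<lambda>a. sc a \<star> x) (carrier R)"
    by (intro inj_on_inverseI[where g = "\<lambda>y. tr (y \<star> z)"]) auto
  then show ?thesis by (simp add: line_def card_image)
qed

text \<open>An element \<open>y\<close> of both annihilators absorbs \<open>conj x\<close> on either side, so it has the form
  \<open>conj x w conj x\<close>, which is a scalar multiple of \<open>conj x\<close> by the sandwich identity.\<close>

lemma rann_inter_lann:
  assumes x: "x \<in> carrier Q" "x \<noteq> \<zero>\<^sub>Q" "nrm x = \<zero>"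
  shows "rann x \<inter> lann x = line (conj x)"
proof
  obtain z where z: "z \<in> carrier Q" "tr (z \<star> x) = \<one>"
    using trace_form_nondegenerate x by blast
  have z': "tr (x \<star> z) = \<one>" using z x tr_mult_comm by metis
  show "rann x \<inter> lann x \<subseteq> line (conj x)"
  proof
    fix y assume y: "y \<in> rann x \<inter> lann x"
    then have "y = conj x \<star> (conj z \<star> (y \<star> conj z \<star> conj x))"
      using absorb_rann[of x z y] absorb_lann[of x z y] x z z' by auto
    then have "y = conj x \<star> (conj z \<star> y \<star> conj z) \<star> conj x"
      using x z y by (simp add: quat.m_assoc rann_def)
    then show "y \<in> line (conj x)"
      using sandwich[of "conj x" "conj z \<star> y \<star> conj z"] x z y
      by (auto simp: line_def rann_def)
  qed
  show "line (conj x) \<subseteq> rann x \<inter> lann x"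
  proof
    fix y assume "y \<in> line (conj x)"
    then obtain a where a: "a \<in> carrier R" "y = sc a \<star> conj x" by (auto simp: line_def)
    have "x \<star> y = sc a \<star> (x \<star> conj x)"
      using a x quat.m_assoc[of x "sc a" "conj x"] sc_central[of a x] by (simp add: quat.m_assoc)
    moreover have "y \<star> x = sc a \<star> (conj x \<star> x)"
      using a x by (simp add: quat.m_assoc)
    ultimately show "y \<in> rann x \<inter> lann x"
      using a x by (simp add: rann_def lann_def nrm_zero_mult_conj)
  qed
qed

text \<open>The two factors are the sizes of the kernel and of the image of left multiplication by \<open>x\<close>.\<close>

lemma card_rann_mult_card_rann_conj:
  assumes x: "x \<in> carrier Q" "x \<noteq> \<zero>\<^sub>Q" "nrm x = \<zero>"
  shows "card (rann x) * card (rann (conj x)) = q ^ 4"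
proof -
  have "card (carrier Q) = card ((\<lambda>w. x \<star> w) ` carrier Q)
      * card {w \<in> carrier Q. x \<star> w = \<zero>\<^sub>Q}"
    by (rule card_eq_card_image_mult_card_kernel[OF quat.abelian_group_axioms quat.abelian_group_axioms])
      (use x finite_quat in \<open>auto simp: quat.r_distr\<close>)
  moreover have "rann (conj x) = (\<lambda>w. x \<star> w) ` carrier Q"
    using rann_eq_right_ideal[of "conj x"] x by simp
  ultimately show ?thesis
    by (simp add: card_quat rann_def[of x] mult.commute)
qed

lemma conj_of_tr_zero:
  assumes "x \<in> carrier Q" "tr x = \<zero>"
  shows "conj x = \<ominus>\<^bsub>Q\<^esub> x"
  using add_conj[of x] assms quat.minus_equality[of "conj x" x] by (simp add: quat.a_comm)

lemma card_rann_nilpotent: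
  assumes x: "x \<in> carrier Q" "x \<noteq> \<zero>\<^sub>Q" "nrm x = \<zero>" "tr x = \<zero>"
  shows "card (rann x) = q ^ 2"
proof -
  have "rann (conj x) = rann x"
    using x by (auto simp: conj_of_tr_zero rann_def quat.l_minus)
  then have "card (rann x) ^ 2 = (q ^ 2) ^ 2"
    using card_rann_mult_card_rann_conj[of x] x by (simp add: power2_eq_square power4_eq_xxxx)
  then show ?thesis by (rule power2_eq_imp_eq) auto
qed

text \<open>If \<open>x Q\<close> were a line, then every quaternion would act on \<open>x\<close> from the right as a scalar. Scalars
  commute, so \<open>x i j = x j i = - x i j\<close>, which is impossible for \<open>x \<noteq> 0\<close> in odd characteristic.\<close>

lemma right_ideal_not_line:
  assumes x: "x \<in> carrier Q" "x \<noteq> \<zero>\<^sub>Q"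
  shows "(\<lambda>w. x \<star> w) ` carrier Q \<noteq> line x"
proof
  assume eq: "(\<lambda>w. x \<star> w) ` carrier Q = line x"
  define i j k where "i = Quat \<zero> \<one> \<zero> \<zero>" and "j = Quat \<zero> \<zero> \<one> \<zero>" and "k = Quat \<zero> \<zero> \<zero> \<one>"
  have ijk: "i \<in> carrier Q" "j \<in> carrier Q" "k \<in> carrier Q"
    by (auto simp: i_def j_def k_def quaternion_ring_simps)
  obtain a b where ab: "a \<in> carrier R" "b \<in> carrier R" "x \<star> i = sc a \<star> x" "x \<star> j = sc b \<star> x"
    using eq ijk by (auto simp: line_def set_eq_iff image_iff) metis
  have "x \<star> (i \<star> j) = sc a \<star> (sc b \<star> x)"
    using ab x ijk by (simp add: quat.m_assoc[symmetric]) (simp add: quat.m_assoc)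
  moreover have "x \<star> (j \<star> i) = sc b \<star> (sc a \<star> x)"
    using ab x ijk by (simp add: quat.m_assoc[symmetric]) (simp add: quat.m_assoc)
  moreover have "sc a \<star> (sc b \<star> x) = sc b \<star> (sc a \<star> x)"
    using ab x by (simp add: quat.m_assoc[symmetric] sc_mult[symmetric] m_comm)
  ultimately have "x \<star> (i \<star> j) = x \<star> (j \<star> i)" by simp
  then have "x \<star> k = \<ominus>\<^bsub>Q\<^esub> (x \<star> k)"
    using quaternion_relations(4,5) x ijk
    by (simp add: i_def j_def k_def quaternion_ring_simps(2)[symmetric] quat.r_minus)
  then have "x \<star> k \<oplus>\<^bsub>Q\<^esub> x \<star> k = x \<star> k \<oplus>\<^bsub>Q\<^esub> \<ominus>\<^bsub>Q\<^esub> (x \<star> k)"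
    by (rule arg_cong)
  also have "\<dots> = \<zero>\<^sub>Q"
    using x ijk by (intro quat.r_neg) simp
  finally have "x \<star> k = \<zero>\<^sub>Q"
    by (rule quat_double_eq_zero[rotated]) (use x ijk in simp)
  moreover have "k \<star> k = \<ominus>\<^bsub>Q\<^esub> \<one>\<^bsub>Q\<^esub>"
    unfolding k_def quaternion_ring_simps(2) by (rule quaternion_relations(3))
  then have "x \<star> k \<star> k = \<ominus>\<^bsub>Q\<^esub> x"
    using x ijk by (simp add: quat.m_assoc quat.r_minus)
  ultimately have "\<ominus>\<^bsub>Q\<^esub> x = \<zero>\<^sub>Q"
    using ijk by simp
  then show False using x quat.minus_minus[of x] by simp
qed

lemma card_trace_zero_mult:
  assumes x: "x \<in> carrier Q"
  shows "card (rann x) = card (tr ` rann x) * card {y \<in> rann x. tr y = \<zero>}"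
  by (rule card_eq_card_image_mult_card_kernel[OF quat.abelian_group_axioms abelian_group_axioms finite_rann])
    (use x in \<open>auto simp: rann_def quat.r_distr quat.r_minus tr_add\<close>)

text \<open>The right annihilator has more than \<open>q\<close> elements because it contains the line of \<open>conj x\<close>
  properly, so the trace is not injective on it.\<close>

lemma exists_nilpotent_in_rann:
  assumes x: "x \<in> carrier Q" "x \<noteq> \<zero>\<^sub>Q" "nrm x = \<zero>"
  obtains y where "y \<in> rann x" "y \<noteq> \<zero>\<^sub>Q" "tr y = \<zero>"
proof -
  have "line (conj x) \<subset> rann x"
    using rann_inter_lann[OF x] rann_eq_right_ideal[OF x] right_ideal_not_line[of "conj x"] x by auto
  then have "q < card (rann x)"
    using psubset_card_mono[OF finite_rann, of "line (conj x)" x] card_line[of "conj x"] x by simp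
  moreover have "card (tr ` rann x) \<le> q"
    using finite_carrier by (intro card_mono) (auto simp: rann_def)
  ultimately have "card (tr ` rann x) < card (tr ` rann x) * card {y \<in> rann x. tr y = \<zero>}"
    using card_trace_zero_mult[OF x(1)] by linarith
  then have "1 < card {y \<in> rann x. tr y = \<zero>}"
    using mult_le_mono2[of "card {y \<in> rann x. tr y = \<zero>}" 1 "card (tr ` rann x)"]
    by (intro not_le_imp_less) auto
  then have "\<not> {y \<in> rann x. tr y = \<zero>} \<subseteq> {\<zero>\<^sub>Q}"
    using card_mono[of "{\<zero>\<^sub>Q}" "{y \<in> rann x. tr y = \<zero>}"] by auto
  then show thesis using that by blast
qed

text \<open>For a nilpotent \<open>y\<close> in the right annihilator, the whole right ideal \<open>y Q\<close> lies in it, and this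
  ideal is itself the annihilator of a nilpotent element.\<close>

lemma card_rann_ge:
  assumes x: "x \<in> carrier Q" "x \<noteq> \<zero>\<^sub>Q" "nrm x = \<zero>"
  shows "q ^ 2 \<le> card (rann x)"
proof -
  obtain y where y: "y \<in> rann x" "y \<noteq> \<zero>\<^sub>Q" "tr y = \<zero>"
    using exists_nilpotent_in_rann x by blast
  then have yc: "y \<in> carrier Q" and xy: "x \<star> y = \<zero>\<^sub>Q" by (auto simp: rann_def)
  have n: "nrm y = \<zero>" using nrm_zero_of_mult_zero' x yc xy by blast
  have "rann (conj y) = (\<lambda>w. y \<star> w) ` carrier Q"
    using rann_eq_right_ideal[of "conj y"] yc y n by simp
  also have "\<dots> \<subseteq> rann x"
    using x yc xy by (auto simp: rann_def quat.m_assoc[symmetric])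
  finally have "card (rann (conj y)) \<le> card (rann x)" by (simp add: card_mono)
  then show ?thesis using card_rann_nilpotent[of "conj y"] y yc n by simp
qed

text \<open>Both \<open>x\<close> and \<open>conj x\<close> have at least \<open>q\<^sup>2\<close> right annihilators, and the two numbers multiply to
  \<open>q\<^sup>4\<close>.\<close>

lemma card_rann:
  assumes x: "x \<in> carrier Q" "x \<noteq> \<zero>\<^sub>Q" "nrm x = \<zero>"
  shows "card (rann x) = q ^ 2"
proof -
  have ge: "q ^ 2 \<le> card (rann x)" "q ^ 2 \<le> card (rann (conj x))"
    using card_rann_ge[of x] card_rann_ge[of "conj x"] x by simp_all
  have "card (rann x) * q ^ 2 \<le> q ^ 2 * q ^ 2"
    unfolding power_add[symmetric]
    using card_rann_mult_card_rann_conj[OF x] mult_le_mono2[OF ge(2), of "card (rann x)"] by simp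
  then have "card (rann x) \<le> q ^ 2"
    using two_le_q unfolding mult_le_cancel2 by simp
  then show ?thesis using ge(1) by simp
qed

text \<open>The element \<open>conj x conj z\<close> of the right annihilator has trace \<open>1\<close>, and its multiples show that the
  trace maps the annihilator onto \<open>F\<close>.\<close>

lemma card_rann_trace_zero:
  assumes x: "x \<in> carrier Q" "x \<noteq> \<zero>\<^sub>Q" "nrm x = \<zero>"
  shows "card {y \<in> rann x. tr y = \<zero>} = q"
proof -
  obtain z where z: "z \<in> carrier Q" "tr (z \<star> x) = \<one>"
    using trace_form_nondegenerate x by blast
  define e where "e = conj x \<star> conj z"
  have e: "e \<in> carrier Q" "tr e = \<one>"
    using x z by (simp_all add: e_def conj_mult[symmetric])
  have "carrier R \<subseteq> tr ` rann x"
  proof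
    fix a assume a: "a \<in> carrier R"
    have "x \<star> (sc a \<star> e) = sc a \<star> (x \<star> conj x \<star> conj z)"
      using a x z sc_central[of a x]
      by (simp add: e_def quat.m_assoc[symmetric])
    then have "sc a \<star> e \<in> rann x"
      using a x z e by (simp add: rann_def nrm_zero_mult_conj)
    moreover have "tr (sc a \<star> e) = a" using a e by (simp add: tr_sc_mult)
    ultimately show "a \<in> tr ` rann x" by (metis image_eqI)
  qed
  then have "tr ` rann x = carrier R" by (auto simp: rann_def)
  then show ?thesis
    using card_trace_zero_mult[OF x(1)] card_rann[OF x] two_le_q by (simp add: power2_eq_square)
qed

lemma lann_eq_conj_rann_conj: "x \<in> carrier Q \<Longrightarrow> lann x = conj ` rann (conj x)"
proof -
  assume x: "x \<in> carrier Q"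
  have "conj y \<in> rann (conj x)" if "y \<in> lann x" for y
    using that x by (simp add: rann_def lann_def conj_mult[symmetric])
  moreover have "conj y \<in> lann x" if "y \<in> rann (conj x)" for y
    using that x conj_mult[of "conj x" y, symmetric] by (simp add: rann_def lann_def)
  ultimately show ?thesis
    by (intro subset_antisym subsetI image_subsetI)
      (auto intro!: image_eqI[where x = "conj _"] simp: rann_def lann_def)
qed

lemma inj_on_conj: "inj_on conj (carrier Q)"
  by (rule inj_on_inverseI[where g = conj]) simp

lemma card_lann:
  assumes x: "x \<in> carrier Q" "x \<noteq> \<zero>\<^sub>Q" "nrm x = \<zero>"
  shows "card (lann x) = q ^ 2"
proof -
  have "card (conj ` rann (conj x)) = card (rann (conj x))"
    by (intro card_image inj_on_subset[OF inj_on_conj]) (auto simp: rann_def)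
  then show ?thesis using lann_eq_conj_rann_conj card_rann[of "conj x"] x by simp
qed

lemma card_lann_trace_zero:
  assumes x: "x \<in> carrier Q" "x \<noteq> \<zero>\<^sub>Q" "nrm x = \<zero>"
  shows "card {y \<in> lann x. tr y = \<zero>} = q"
proof -
  have "{y \<in> lann x. tr y = \<zero>} = conj ` {y \<in> rann (conj x). tr y = \<zero>}"
    using x by (auto simp: lann_eq_conj_rann_conj rann_def)
  moreover have "card (conj ` {y \<in> rann (conj x). tr y = \<zero>}) = card {y \<in> rann (conj x). tr y = \<zero>}"
    by (intro card_image inj_on_subset[OF inj_on_conj]) (auto simp: rann_def)
  ultimately show ?thesis using card_rann_trace_zero[of "conj x"] x by simp
qed


section \<open>Existence of zero divisors\<close>

lemma square_fibre_card:
  assumes s: "s \<in> carrier R"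
  shows "card {a \<in> carrier R. a \<otimes> a = s} \<le> 2"
proof (cases "\<exists>b \<in> carrier R. b \<otimes> b = s")
  case True
  then obtain b where b: "b \<in> carrier R" "b \<otimes> b = s" by blast
  have "{a \<in> carrier R. a \<otimes> a = s} \<subseteq> {b, \<ominus> b}"
  proof
    fix a assume a: "a \<in> {a \<in> carrier R. a \<otimes> a = s}"
    have "(a \<ominus> b) \<otimes> (a \<oplus> b) = a \<otimes> a \<ominus> b \<otimes> b"
    proof -
      have cancel: "u \<oplus> (\<ominus> v \<oplus> (v \<oplus> \<ominus> w)) = u \<oplus> \<ominus> w"
        if "u \<in> carrier R" "v \<in> carrier R" "w \<in> carrier R" for u v w
        using that by (simp add: r_neg1 r_neg2)
      have "(a \<ominus> b) \<otimes> (a \<oplus> b) = a \<otimes> a \<oplus> (\<ominus> (a \<otimes> b) \<oplus> (a \<otimes> b \<oplus> \<ominus> (b \<otimes> b)))"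
        using a b by (auto simp: cring_simprules)
      then show ?thesis using a b cancel[of "a \<otimes> a" "a \<otimes> b" "b \<otimes> b"] s by (simp add: minus_eq)
    qed
    also have "\<dots> = \<zero>" using a b s by (simp add: minus_eq r_neg)
    finally have "a \<ominus> b = \<zero> \<or> a \<oplus> b = \<zero>" using a b integral[of "a \<ominus> b" "a \<oplus> b"] by auto
    then show "a \<in> {b, \<ominus> b}"
      using a b minus_equality[of a b] by auto
  qed
  then have "card {a \<in> carrier R. a \<otimes> a = s} \<le> card {b, \<ominus> b}" by (intro card_mono) auto
  also have "\<dots> \<le> 2" by (simp add: card_insert_if)
  finally show ?thesis .
next
  case False
  then have "{a \<in> carrier R. a \<otimes> a = s} = {}" by auto
  then show ?thesis by (simp only: card.empty)
qed

text \<open>Squaring is at most two-to-one and takes the value \<open>0\<close> only at \<open>0\<close>, so there are more than \<open>q / 2\<close>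
  squares. Hence the set \<open>S\<close> of squares meets its reflected translate \<open>T\<close>, which consists of all \<open>- (1 + s)\<close> with \<open>s \<in> S\<close>.\<close>

lemma minus_one_sum_of_two_squares:
  obtains a b where "a \<in> carrier R" "b \<in> carrier R" "\<one> \<oplus> a \<otimes> a \<oplus> b \<otimes> b = \<zero>"
proof -
  define S where "S = (\<lambda>a. a \<otimes> a) ` carrier R"
  define T where "T = (\<lambda>s. \<ominus> (\<one> \<oplus> s)) ` S"
  have S: "S \<subseteq> carrier R" "finite S" "\<zero> \<in> S"
    using finite_carrier by (auto simp: S_def image_iff intro!: bexI[of _ \<zero>])
  have "inj_on (\<lambda>s. \<ominus> (\<one> \<oplus> s)) S"
  proof (rule inj_onI)
    fix s t assume "s \<in> S" "t \<in> S" and eq: "\<ominus> (\<one> \<oplus> s) = \<ominus> (\<one> \<oplus> t)"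
    then have st: "s \<in> carrier R" "t \<in> carrier R" using S(1) by auto
    have "\<ominus> (\<ominus> (\<one> \<oplus> s)) = \<ominus> (\<ominus> (\<one> \<oplus> t))" by (simp only: eq)
    then have "\<one> \<oplus> s = \<one> \<oplus> t" using st by (simp only: minus_minus a_closed one_closed)
    with st show "s = t" using r_neg1[of \<one> s] r_neg1[of \<one> t] by simp
  qed
  then have card_T: "card T = card S" by (simp add: T_def card_image)
  have "q = (\<Sum>s\<in>S. card {a \<in> carrier R. a \<otimes> a = s})"
    using sum.image_gen[OF finite_carrier, of "\<lambda>_. 1::nat" "\<lambda>a. a \<otimes> a"] by (simp add: S_def)
  also have "\<dots> = card {a \<in> carrier R. a \<otimes> a = \<zero>} + (\<Sum>s\<in>S - {\<zero>}. card {a \<in> carrier R. a \<otimes> a = s})"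
    using S by (simp add: sum.remove)
  also have "{a \<in> carrier R. a \<otimes> a = \<zero>} = {\<zero>}"
    using integral by auto
  also have "(\<Sum>s\<in>S - {\<zero>}. card {a \<in> carrier R. a \<otimes> a = s}) \<le> (\<Sum>s\<in>S - {\<zero>}. 2)"
    using S(1) square_fibre_card by (intro sum_mono) auto
  finally have "q < 2 * card S"
    using S card_gt_0_iff[of S] by auto
  moreover have "T \<subseteq> carrier R" using S(1) by (auto simp: T_def)
  then have "card (S \<union> T) \<le> q"
    using S finite_carrier by (intro card_mono) auto
  ultimately have "card (S \<union> T) \<noteq> card S + card T"
    using card_T by linarith
  then have "S \<inter> T \<noteq> {}"
    using card_Un_disjoint[of S T] S by (auto simp: T_def)
  then obtain a b where ab: "a \<in> carrier R" "b \<in> carrier R" "b \<otimes> b = \<ominus> (\<one> \<oplus> a \<otimes> a)"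
    by (auto simp: S_def T_def)
  then have "\<one> \<oplus> a \<otimes> a \<oplus> b \<otimes> b = \<zero>" by (simp add: r_neg)
  with ab that show thesis by blast
qed

lemma zero_divisors_nonempty: "zero_divisors Q \<noteq> {}"
proof -
  obtain a b where ab: "a \<in> carrier R" "b \<in> carrier R" "\<one> \<oplus> a \<otimes> a \<oplus> b \<otimes> b = \<zero>"
    using minus_one_sum_of_two_squares by blast
  have "Quat \<one> a b \<zero> \<in> zero_divisors Q"
    unfolding zero_divisors_quaternion_ring using ab by (simp add: quaternion_ring_simps)
  then show ?thesis by blast
qed


section \<open>Neighbourhoods in the zero divisor graph\<close>

definition neighbours where
  "neighbours x = {y. (x, y) \<in> parcs (zero_divisor_graph Q)}"

lemma neighbours_eq:
  assumes x: "x \<in> zero_divisors Q"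
  shows "neighbours x = (rann x \<union> lann x) - {\<zero>\<^sub>Q, x}"
  using x by (auto simp: neighbours_def zero_divisor_graph_def rann_def lann_def zero_divisors_def)

lemma card_annihilators:
  assumes x: "x \<in> carrier Q" "x \<noteq> \<zero>\<^sub>Q" "nrm x = \<zero>"
  shows "card (rann x \<union> lann x) + q = 2 * q ^ 2"
  using card_Un_Int[of "rann x" "lann x"] card_rann[OF x] card_lann[OF x] rann_inter_lann[OF x]
    card_line[of "conj x"] x by simp

text \<open>The trace-zero parts of the two annihilators, with \<open>q\<close> elements each, meet in the trace-zero part of
  the line of \<open>conj x\<close>: this is the whole line if \<open>tr x = 0\<close>, and only \<open>0\<close> otherwise.\<close>

lemma card_annihilators_trace_zero:
  assumes x: "x \<in> carrier Q" "x \<noteq> \<zero>\<^sub>Q" "nrm x = \<zero>"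
  shows "card {y \<in> rann x \<union> lann x. tr y = \<zero>} = (if tr x = \<zero> then q else 2 * q - 1)"
proof -
  let ?A = "{y \<in> rann x. tr y = \<zero>}" and ?B = "{y \<in> lann x. tr y = \<zero>}"
  have union: "{y \<in> rann x \<union> lann x. tr y = \<zero>} = ?A \<union> ?B" by auto
  have inter: "?A \<inter> ?B = {y \<in> line (conj x). tr y = \<zero>}"
    using rann_inter_lann[OF x] by auto
  have tr_line: "tr (sc a \<star> conj x) = a \<otimes> tr x" if "a \<in> carrier R" for a
    using that x by (simp add: tr_sc_mult)
  have "card (?A \<inter> ?B) = (if tr x = \<zero> then q else 1)"
  proof (cases "tr x = \<zero>")
    case True
    then have "?A \<inter> ?B = line (conj x)"
      unfolding inter using tr_line by (auto simp: line_def)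
    then show ?thesis using card_line[of "conj x"] x True by simp
  next
    case False
    then have "?A \<inter> ?B = {\<zero>\<^sub>Q}"
      unfolding inter line_def using tr_line x
      by (auto simp: integral_iff intro!: image_eqI[where x = \<zero>])
    then show ?thesis using False by simp
  qed
  then show ?thesis
    unfolding union
    using card_Un_Int[of ?A ?B] card_rann_trace_zero[OF x] card_lann_trace_zero[OF x]
    by (auto split: if_splits)
qed

lemma square_eq_trace_mult:
  assumes "x \<in> carrier Q" "nrm x = \<zero>"
  shows "x \<star> x = sc (tr x) \<star> x"
  using sandwich[of x "\<one>\<^bsub>Q\<^esub>"] assms by simp

text \<open>A nilpotent \<open>x\<close> annihilates itself, so besides \<open>0\<close> also \<open>x\<close> has to be discarded from its
  annihilators; no other isotropic \<open>x\<close> lies in them.\<close>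

lemma card_neighbours_trace_zero:
  assumes x: "x \<in> zero_divisors Q"
  shows "card {y \<in> neighbours x. tr y = \<zero>} = (if tr x = \<zero> then q - 2 else 2 * (q - 1))"
proof -
  have x': "x \<in> carrier Q" "x \<noteq> \<zero>\<^sub>Q" "nrm x = \<zero>"
    using x by (auto simp: zero_divisors_quaternion_ring)
  let ?T = "{y \<in> rann x \<union> lann x. tr y = \<zero>}"
  have zero: "\<zero>\<^sub>Q \<in> ?T" using x' by (simp add: rann_def)
  show ?thesis
  proof (cases "tr x = \<zero>")
    case True
    then have "x \<in> ?T" using x' square_eq_trace_mult[of x] by (simp add: rann_def)
    moreover have "{y \<in> neighbours x. tr y = \<zero>} = ?T - {\<zero>\<^sub>Q, x}"
      by (auto simp: neighbours_eq[OF x])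
    ultimately show ?thesis
      using zero x' True card_annihilators_trace_zero[OF x'] by (simp add: card_Diff_subset)
  next
    case False
    then have "{y \<in> neighbours x. tr y = \<zero>} = ?T - {\<zero>\<^sub>Q}"
      by (auto simp: neighbours_eq[OF x])
    then show ?thesis
      using zero False card_annihilators_trace_zero[OF x'] two_le_q by (simp add: card_Diff_subset)
  qed
qed

lemma card_neighbours_trace_nonzero:
  assumes x: "x \<in> zero_divisors Q"
  shows "card {y \<in> neighbours x. tr y \<noteq> \<zero>} =
    (if tr x = \<zero> then 2 * q * (q - 1) else (2 * q - 1) * (q - 1))"
proof -
  have x': "x \<in> carrier Q" "x \<noteq> \<zero>\<^sub>Q" "nrm x = \<zero>"
    using x by (auto simp: zero_divisors_quaternion_ring)
  let ?S = "rann x \<union> lann x" and ?T = "{y \<in> rann x \<union> lann x. tr y = \<zero>}"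
  have "x \<notin> ?S" if "tr x \<noteq> \<zero>"
    using that x' square_eq_trace_mult[of x] sc_mult_eq_zero[of "tr x" x]
    by (auto simp: rann_def lann_def)
  then have "{y \<in> neighbours x. tr y \<noteq> \<zero>} = ?S - ?T"
    by (auto simp: neighbours_eq[OF x])
  then have "card {y \<in> neighbours x. tr y \<noteq> \<zero>} = card ?S - card ?T"
    by (simp only:) (rule card_Diff_subset, auto)
  (* The substitution removes the truncated subtractions. *)
  moreover obtain r where r: "q = r + 2" using two_le_q by (metis le_add_diff_inverse2)
  ultimately show ?thesis
    using card_annihilators[OF x'] card_annihilators_trace_zero[OF x']
    by (auto simp: r power2_eq_square algebra_simps)
qed


section \<open>The spectral radius\<close>

theorem spectral_radius_zero_divisor_graph_quaternion_ring:
  assumes vs: "distinct vs" "set vs = pverts (zero_divisor_graph Q)"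
  shows "spectral_radius (adjacency_matrix (zero_divisor_graph Q) vs) =
    real q ^ 2 - real q - 1 / 2 + 1 / 2 * sqrt (4 * real q ^ 4 - 4 * real q ^ 2 - 8 * real q + 9)"
    (is "_ = ?\<rho>")
proof (rule spectral_radius_eq_of_positive_eigenvector)
  (* With these two values the first row of the 2 x 2 matrix gives the eigenvalue equation
     identically in the eigenvalue; the second row is then the characteristic equation. *)
  define g where "g y = (if tr y = \<zero> then 2 * real q * (real q - 1) else ?\<rho> - (real q - 2))" for y
  have set_vs: "set vs = zero_divisors Q" using vs by (simp add: zero_divisor_graph_def)
  have q2: "real q \<ge> 2" using two_le_q by simp
  let ?a = "\<lambda>i j. if (vs ! i, vs ! j) \<in> parcs (zero_divisor_graph Q) then 1 else 0 :: real"
  show "adjacency_matrix (zero_divisor_graph Q) vs \<in> carrier_mat (length vs) (length vs)"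
    by (simp add: adjacency_matrix_def)
  show "length vs > 0" using zero_divisors_nonempty set_vs by auto
  show "adjacency_matrix (zero_divisor_graph Q) vs $$ (i, j) = complex_of_real (?a i j)"
    if "i < length vs" "j < length vs" for i j
    using that by (simp add: adjacency_matrix_def)
  (* The discriminant of the 2 x 2 matrix as (difference of the diagonal entries)^2
     + 4 * (product of the other two entries). *)
  have disc: "4 * real q ^ 4 - 4 * real q ^ 2 - 8 * real q + 9
      = (2 * real q ^ 2 - 4 * real q + 3) ^ 2 + 16 * real q * (real q - 1) ^ 2"
    by (simp add: power2_eq_square power4_eq_xxxx algebra_simps)
  define s where "s = sqrt (4 * real q ^ 4 - 4 * real q ^ 2 - 8 * real q + 9)"
  have s: "s ^ 2 = (2 * real q ^ 2 - 4 * real q + 3) ^ 2 + 16 * real q * (real q - 1) ^ 2" "s \<ge> 0"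
    unfolding s_def disc by simp_all
  have rho: "?\<rho> = real q ^ 2 - real q - 1 / 2 + 1 / 2 * s" by (simp add: s_def)
  have "?\<rho> - (real q - 2) = (real q - 1) ^ 2 + 1 / 2 + 1 / 2 * s"
    unfolding rho by (simp add: power2_eq_square algebra_simps)
  then have g2: "?\<rho> - (real q - 2) > 0" using s(2) by (simp add: add_nonneg_pos add_pos_nonneg)
  show "g (vs ! i) > 0" if "i < length vs" for i
    using q2 g2 by (simp add: g_def)
  have char: "(?\<rho> - (real q - 2)) * (?\<rho> - (2 * real q - 1) * (real q - 1)) = 4 * real q * (real q - 1) ^ 2"
  proof -
    have "(?\<rho> - (real q - 2)) * (?\<rho> - (2 * real q - 1) * (real q - 1))
      = (s ^ 2 - (2 * real q ^ 2 - 4 * real q + 3) ^ 2) / 4"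
      unfolding rho by (simp add: power2_eq_square algebra_simps)
    then show ?thesis by (simp add: s(1))
  qed
  show "(\<Sum>j<length vs. ?a i j * g (vs ! j)) = ?\<rho> * g (vs ! i)" if i: "i < length vs" for i
  proof -
    define x where "x = vs ! i"
    have x: "x \<in> zero_divisors Q" using i set_vs nth_mem by (auto simp: x_def)
    have sub: "neighbours x \<subseteq> set vs"
      by (auto simp: neighbours_def zero_divisor_graph_def set_vs)
    have fin: "finite (neighbours x)" using sub by (rule finite_subset) simp
    have "(\<Sum>j<length vs. ?a i j * g (vs ! j)) = (\<Sum>y\<in>set vs. (if y \<in> neighbours x then g y else 0))"
      using sum.reindex_bij_betw[OF bij_betw_nth[OF vs(1) refl refl], of "\<lambda>y. if y \<in> neighbours x then g y else 0"]
      by (simp add: neighbours_def x_def if_distrib[of "\<lambda>t. t * _"] cong: if_cong)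
    also have "\<dots> = (\<Sum>y\<in>neighbours x. g y)"
      using sub by (simp add: sum.inter_restrict[symmetric] Int_absorb1)
    also have "\<dots> = real (card {y \<in> neighbours x. tr y = \<zero>}) * (2 * real q * (real q - 1))
        + real (card {y \<in> neighbours x. tr y \<noteq> \<zero>}) * (?\<rho> - (real q - 2))"
      unfolding g_def using fin by (simp add: sum.If_cases Int_def)
    also have "\<dots> = ?\<rho> * g x"
    proof (cases "tr x = \<zero>")
      case True
      have cards: "real (card {y \<in> neighbours x. tr y = \<zero>}) = real q - 2"
        "real (card {y \<in> neighbours x. tr y \<noteq> \<zero>}) = 2 * real q * (real q - 1)"
        using card_neighbours_trace_zero[OF x] card_neighbours_trace_nonzero[OF x] two_le_q True
        by (simp_all add: of_nat_diff)
      have "g x = 2 * real q * (real q - 1)" using True by (simp add: g_def)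
      then show ?thesis
        unfolding cards by (simp only:) (simp add: algebra_simps)
    next
      case False
      have cards: "real (card {y \<in> neighbours x. tr y = \<zero>}) = 2 * (real q - 1)"
        "real (card {y \<in> neighbours x. tr y \<noteq> \<zero>}) = (2 * real q - 1) * (real q - 1)"
        using card_neighbours_trace_zero[OF x] card_neighbours_trace_nonzero[OF x] two_le_q False
        by (simp_all add: of_nat_diff)
      have g: "g x = ?\<rho> - (real q - 2)" using False by (simp add: g_def)
      have eigen: "2 * (u - 1) * (2 * u * (u - 1)) + (2 * u - 1) * (u - 1) * (t - (u - 2)) = t * (t - (u - 2))"
        if "(t - (u - 2)) * (t - (2 * u - 1) * (u - 1)) = 4 * u * (u - 1) ^ 2" for t u :: real
        using that by (simp add: power2_eq_square algebra_simps)
      show ?thesis unfolding cards g by (rule eigen[OF char])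
    qed
    finally show ?thesis by (simp add: x_def)
  qed
qed auto

end

lemma (in residues_prime) finite_odd_field_residue_ring:
  assumes "odd p"
  shows "finite_odd_field R"
proof unfold_locales
  have p: "p > 2" using assms prime_gt_1_nat[OF p_prime] by (cases "p = 2") auto
  show "finite (carrier R)" by (rule finite)
  show "\<one> \<oplus> \<one> \<noteq> \<zero>"
    using p by (simp add: res_one_eq res_zero_eq res_add_eq)
qed

theorem theorem4p6:
  fixes p :: nat and vs :: "int quat list"
  assumes "prime p" and "odd p"
    and "distinct vs" and "set vs = pverts (zero_divisor_graph (lipschitz_ring p))"
  shows "spectral_radius (adjacency_matrix (zero_divisor_graph (lipschitz_ring p)) vs) =
    real p ^ 2 - real p - 1 / 2 + 1 / 2 * sqrt (4 * real p ^ 4 - 4 * real p ^ 2 - 8 * real p + 9)"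
proof -
  interpret residues_prime p "residue_ring (int p)"
    by unfold_locales (use assms in auto)
  interpret finite_odd_field "residue_ring (int p)"
    by (rule finite_odd_field_residue_ring) fact
  have "card (carrier (residue_ring (int p))) = p" by (simp add: res_carrier_eq)
  then show ?thesis
    using spectral_radius_zero_divisor_graph_quaternion_ring[of vs] assms(3,4)
    by (simp add: lipschitz_ring_def)
qed

end
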